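(* Let $S$ be a finitely generated right act over the free monoid $W_r$ of rank $r>1$, with growth function $g(n)$ (with respect to a finite generating set). If the function $\dfrac{r^n}{g(n)}$ is subexponential, then $S$ is faithful. In particular, any $W_r$-act of maximal growth is faithful.
   Context: An act $S$ over a monoid $M$ is faithful if for any two different $u,v\in M$ there is $s\in S$ such that $su\ne sv$. A function $f$ on $\mathbb{N}$ with positive values is subexponential if $\limsup_{n\to\infty}\sqrt[n]{f(n)}\le1$. $W(n)$ is the set of words of length at most $n$ in the $r$ free generators of $W_r$ ($r$ finite). For an act $S$ generated by a finite set $A$ the growth function is $g(n)=g_{A,S}(n)=\#(A\,W(n))$. Functions $f,g$ are equivalent if for some nonnegative integers $C,C'$ one has $f(n)\le g(n+C)$ and $g(n)\le f(n+C')$ for all $n\ge0$. A finitely generated act has maximal growth if its growth function is equivalent to that of the free act of rank 1, i.e. to $r^n$ (independently of the finite generating set); an arbitrary act has maximal growth if it contains a finitely generated subact of maximal growth. *)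

theory Defs
  imports "HOL-Algebra.Group" "HOL-Library.Liminf_Limsup" "HOL-Library.Extended_Real"
begin

text \<open>Acts are given by an explicit carrier set \<open>S\<close>; only the values of \<open>act\<close> on
  \<open>S \<times> carrier M\<close> matter. The empty act is allowed.\<close>

locale right_act = monoid M for M (structure) +
  fixes S :: "'s set" and act :: "'s \<Rightarrow> 'a \<Rightarrow> 's"
  assumes act_closed: "\<lbrakk>s \<in> S; u \<in> carrier M\<rbrakk> \<Longrightarrow> act s u \<in> S"
    and act_one: "s \<in> S \<Longrightarrow> act s \<one> = s"
    and act_mult: "\<lbrakk>s \<in> S; u \<in> carrier M; v \<in> carrier M\<rbrakk>
      \<Longrightarrow> act (act s u) v = act s (u \<otimes> v)"

definition faithful_act :: "('a, 'b) monoid_scheme \<Rightarrow> 's set \<Rightarrow> ('s \<Rightarrow> 'a \<Rightarrow> 's) \<Rightarrow> bool" where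
  "faithful_act M S act \<longleftrightarrow>
    (\<forall>u \<in> carrier M. \<forall>v \<in> carrier M. u \<noteq> v \<longrightarrow> (\<exists>s \<in> S. act s u \<noteq> act s v))"

definition subact :: "('a, 'b) monoid_scheme \<Rightarrow> 's set \<Rightarrow> 's set \<Rightarrow> ('s \<Rightarrow> 'a \<Rightarrow> 's) \<Rightarrow> bool" where
  "subact M T S act \<longleftrightarrow> T \<subseteq> S \<and> (\<forall>t \<in> T. \<forall>u \<in> carrier M. act t u \<in> T)"

text \<open>The set \<open>A U\<close> of all \<open>a u\<close> with \<open>a \<in> A\<close>, \<open>u \<in> U\<close>.\<close>

definition act_set :: "('s \<Rightarrow> 'a \<Rightarrow> 's) \<Rightarrow> 's set \<Rightarrow> 'a set \<Rightarrow> 's set" where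
  "act_set act A U = {act a u | a u. a \<in> A \<and> u \<in> U}"

definition generates_act ::
  "('a, 'b) monoid_scheme \<Rightarrow> 's set \<Rightarrow> ('s \<Rightarrow> 'a \<Rightarrow> 's) \<Rightarrow> 's set \<Rightarrow> bool" where
  "generates_act M S act A \<longleftrightarrow> A \<subseteq> S \<and> S = act_set act A (carrier M)"

text \<open>The free monoid on an alphabet \<open>X\<close>; its rank is \<open>card X\<close>.\<close>

definition free_monoid :: "'x set \<Rightarrow> 'x list monoid" where
  "free_monoid X = \<lparr>carrier = lists X, mult = (@), one = []\<rparr>"

definition words_upto :: "'x set \<Rightarrow> nat \<Rightarrow> 'x list set" where
  "words_upto X n = {w \<in> lists X. length w \<le> n}"

definition growth :: "'x set \<Rightarrow> ('s \<Rightarrow> 'x list \<Rightarrow> 's) \<Rightarrow> 's set \<Rightarrow> nat \<Rightarrow> nat" where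
  "growth X act A n = card (act_set act A (words_upto X n))"

definition subexponential :: "(nat \<Rightarrow> real) \<Rightarrow> bool" where
  "subexponential f \<longleftrightarrow> (\<forall>n. f n > 0) \<and> limsup (\<lambda>n. ereal (root n (f n))) \<le> 1"

definition growth_equiv :: "(nat \<Rightarrow> nat) \<Rightarrow> (nat \<Rightarrow> nat) \<Rightarrow> bool" where
  "growth_equiv f g \<longleftrightarrow> (\<exists>C. \<forall>n. f n \<le> g (n + C)) \<and> (\<exists>C'. \<forall>n. g n \<le> f (n + C'))"

text \<open>The free act of rank 1 is the monoid acting on itself by right multiplication,
  generated by the empty word. Neither the choice of the finite generating set \<open>A\<close> nor
  the replacement of the growth of the free act by the function \<open>r ^ n\<close> matters: see
  \<open>growth_equiv_generators\<close> and \<open>growth_free_act_equiv\<close> below.\<close>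

definition fg_maximal_growth :: "'x set \<Rightarrow> 's set \<Rightarrow> ('s \<Rightarrow> 'x list \<Rightarrow> 's) \<Rightarrow> bool" where
  "fg_maximal_growth X S act \<longleftrightarrow>
    (\<exists>A. finite A \<and> generates_act (free_monoid X) S act A \<and>
      growth_equiv (growth X act A)
        (growth X (mult (free_monoid X)) {one (free_monoid X)}))"

definition maximal_growth :: "'x set \<Rightarrow> 's set \<Rightarrow> ('s \<Rightarrow> 'x list \<Rightarrow> 's) \<Rightarrow> bool" where
  "maximal_growth X S act \<longleftrightarrow>
    (\<exists>T. subact (free_monoid X) T S act \<and> fg_maximal_growth X T act)"

lemma free_monoid_simps [simp]:
  "carrier (free_monoid X) = lists X"
  "mult (free_monoid X) = (@)"
  "one (free_monoid X) = []"
  by (simp_all add: free_monoid_def)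

lemma monoid_free_monoid: "monoid (free_monoid X)"
  by unfold_locales auto

lemma finite_words_upto: "finite X \<Longrightarrow> finite (words_upto X n)"
  using finite_lists_length_le[of X n] by (simp add: words_upto_def lists_eq_set)

lemma finite_act_set: "finite A \<Longrightarrow> finite U \<Longrightarrow> finite (act_set act A U)"
proof -
  assume "finite A" "finite U"
  moreover have "act_set act A U = case_prod act ` (A \<times> U)"
    by (auto simp: act_set_def)
  ultimately show ?thesis by simp
qed

lemma growth_le_shift:
  assumes "right_act (free_monoid X) S act" "finite X"
    and "finite A" "A \<subseteq> S" "finite B" "generates_act (free_monoid X) S act B"
  shows "\<exists>C. \<forall>n. growth X act A n \<le> growth X act B (n + C)"
proof -
  interpret right_act "free_monoid X" S act by fact
  have B: "B \<subseteq> S" and "\<forall>a \<in> A. \<exists>b w. b \<in> B \<and> w \<in> lists X \<and> a = act b w"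
    using assms(4,6) unfolding generates_act_def act_set_def free_monoid_simps by blast+
  then obtain b w where bw: "\<And>a. a \<in> A \<Longrightarrow> b a \<in> B \<and> w a \<in> lists X \<and> a = act (b a) (w a)"
    by metis
  define C where "C = Max (insert 0 ((\<lambda>a. length (w a)) ` A))"
  have C: "length (w a) \<le> C" if "a \<in> A" for a
    unfolding C_def using that \<open>finite A\<close> by (intro Max_ge) auto
  have "act_set act A (words_upto X n) \<subseteq> act_set act B (words_upto X (n + C))" for n
  proof
    fix s assume "s \<in> act_set act A (words_upto X n)"
    then obtain a u where au: "a \<in> A" "u \<in> lists X" "length u \<le> n" "s = act a u"
      by (auto simp: act_set_def words_upto_def)
    have "s = act (act (b a) (w a)) u"
      using au bw by metis
    also have "\<dots> = act (b a) (w a @ u)"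
      using act_mult[of "b a" "w a" u] bw[OF au(1)] au B by auto
    finally have "s = act (b a) (w a @ u)" .
    moreover have "w a @ u \<in> words_upto X (n + C)"
      using bw[OF au(1)] au C[OF au(1)] by (simp add: words_upto_def)
    ultimately show "s \<in> act_set act B (words_upto X (n + C))"
      using bw[OF au(1)] unfolding act_set_def by blast
  qed
  then show ?thesis
    unfolding growth_def
    by (meson card_mono finite_act_set finite_words_upto \<open>finite B\<close> \<open>finite X\<close>)
qed

lemma growth_equiv_generators:
  assumes "right_act (free_monoid X) S act" "finite X"
    and "finite A" "generates_act (free_monoid X) S act A"
    and "finite B" "generates_act (free_monoid X) S act B"
  shows "growth_equiv (growth X act A) (growth X act B)"
proof -
  have "A \<subseteq> S" "B \<subseteq> S"
    using assms(4,6) by (auto simp: generates_act_def)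
  then show ?thesis
    unfolding growth_equiv_def using growth_le_shift assms by blast
qed

lemma growth_free_act:
  assumes "finite X"
  shows "growth X (mult (free_monoid X)) {one (free_monoid X)} n = (\<Sum>i\<le>n. card X ^ i)"
proof -
  have "act_set (@) {[]} (words_upto X n) = {w. set w \<subseteq> X \<and> length w \<le> n}"
    by (auto simp: act_set_def words_upto_def lists_eq_set)
  then show ?thesis
    by (simp add: growth_def card_lists_length_le assms)
qed

lemma growth_free_act_equiv:
  assumes "finite X" "card X > 1"
  shows "growth_equiv (growth X (mult (free_monoid X)) {one (free_monoid X)}) (\<lambda>n. card X ^ n)"
proof -
  let ?r = "card X"
  have "(\<Sum>i\<le>n. ?r ^ i) \<le> ?r ^ (n + 1)" for n
  proof (induction n)
    case (Suc n)
    have "(\<Sum>i\<le>Suc n. ?r ^ i) \<le> 2 * ?r ^ Suc n" using Suc by simp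
    also have "\<dots> \<le> ?r * ?r ^ Suc n" using assms(2) by (intro mult_right_mono) auto
    finally show ?case by simp
  qed (use assms in simp)
  moreover have "?r ^ n \<le> (\<Sum>i\<le>n + 0. ?r ^ i)" for n
    by (intro member_le_sum) auto
  ultimately show ?thesis
    unfolding growth_equiv_def growth_free_act[OF assms(1)] by blast
qed

end

theory Submission
  imports Defs
begin

text \<open>If two different words \<open>u\<close>, \<open>v\<close> act identically, then so do \<open>p = u c v\<close> and \<open>q = v c u\<close>, which
  have equal length \<open>k \<ge> 2\<close> and are different for a suitable letter \<open>c\<close>. In every product ending in a word of length \<open>k\<close>, the ending \<open>p\<close> may be replaced
  by \<open>q\<close>, so lengthening words by \<open>k\<close> multiplies the number of reachable elements by at most
  \<open>r ^ k - 1\<close>. Hence the growth has exponential rate at most the \<open>k\<close>-th root of \<open>r ^ k - 1\<close>, which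
  is less than \<open>r\<close>.\<close>

section \<open>Words of a fixed length\<close>

definition words_of_length :: "'x set \<Rightarrow> nat \<Rightarrow> 'x list set" where
  "words_of_length X n = {w \<in> lists X. length w = n}"

lemma words_of_length_eq: "words_of_length X n = {w. set w \<subseteq> X \<and> length w = n}"
  by (auto simp: words_of_length_def)

lemma finite_words_of_length: "finite X \<Longrightarrow> finite (words_of_length X n)"
  by (simp add: words_of_length_eq finite_lists_length_eq)

lemma card_words_of_length: "finite X \<Longrightarrow> card (words_of_length X n) = card X ^ n"
  by (simp add: words_of_length_eq card_lists_length_eq)

lemma card_act_set_le:
  assumes "finite A" "finite U"
  shows "card (act_set act A U) \<le> card A * card U"
proof -
  have "act_set act A U = case_prod act ` (A \<times> U)"
    by (auto simp: act_set_def)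
  then show ?thesis
    using assms card_image_le[of "A \<times> U" "case_prod act"] by (simp add: card_cartesian_product)
qed

section \<open>Identities between words and their effect on counting\<close>

lemma equal_length_identity:
  assumes "right_act (free_monoid X) S act" "card X > 1"
    and uv: "u \<in> lists X" "v \<in> lists X" "u \<noteq> v" "\<And>s. s \<in> S \<Longrightarrow> act s u = act s v"
  obtains p q where "p \<in> lists X" "q \<in> lists X" "p \<noteq> q" "length p = length q" "length p \<ge> 2"
    "\<And>s. s \<in> S \<Longrightarrow> act s p = act s q"
proof -
  interpret right_act "free_monoid X" S act by fact
  note result = that
  have thesis
    if uv: "u \<in> lists X" "v \<in> lists X" "u \<noteq> v" "\<And>s. s \<in> S \<Longrightarrow> act s u = act s v"
      and le: "length v \<le> length u" for u v
  proof -
    \<comment> \<open>If \<open>v\<close> is shorter, position \<open>length v\<close> holds a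
      letter of \<open>u\<close> in \<open>?p\<close> but \<open>c\<close> in \<open>?q\<close>, so
      \<open>c\<close> must avoid that letter. For equal lengths \<open>u ! length v\<close> is an
      out-of-range value and any \<open>c\<close> works, since the prefixes \<open>u\<close> and
      \<open>v\<close> already differ.\<close>
    have "\<not> X \<subseteq> {u ! length v}"
      using \<open>card X > 1\<close> card_mono[of "{u ! length v}" X] by auto
    then obtain c where c: "c \<in> X" "c \<noteq> u ! length v" by blast
    let ?p = "u @ [c] @ v" and ?q = "v @ [c] @ u"
    have "?p \<noteq> ?q"
    proof (cases "length v = length u")
      case True
      then show ?thesis using uv(3) by simp
    next
      case False
      then have "?p ! length v = u ! length v" "?q ! length v = c"
        using le by (auto simp: nth_append)
      then show ?thesis using c by metis
    qed
    moreover have "act s ?p = act s ?q" if "s \<in> S" for s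
    proof -
      have "act s ?p = act (act (act s u) [c]) v"
        using that uv c act_mult[of s u "[c] @ v"] act_mult[of "act s u" "[c]" v]
          act_closed[of s u] by simp
      \<comment> \<open>The identity is used twice: to change \<open>u\<close> into \<open>v\<close>
        at \<open>s\<close>, then \<open>v\<close> into \<open>u\<close> at
        \<open>act (act s v) [c]\<close>, which is again a point of \<open>S\<close>.\<close>
      also have "\<dots> = act (act (act s v) [c]) u"
        using that uv c act_closed[of s v] act_closed[of "act s v" "[c]"] by simp
      also have "\<dots> = act s ?q"
        using that uv c act_mult[of s v "[c] @ u"] act_mult[of "act s v" "[c]" u]
          act_closed[of s v] by simp
      finally show ?thesis .
    qed
    moreover have "u \<noteq> []" using uv(3) le by auto
    then have "length ?p \<ge> 2" by (cases u) auto
    ultimately show thesis using result[of ?p ?q] uv c by simp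
  qed
  from this[of u v] this[of v u] show thesis
    using uv by (metis nat_le_linear)
qed

lemma card_act_set_lengthen:
  assumes "right_act (free_monoid X) S act" "finite X" "finite A" "A \<subseteq> S"
    and p: "p \<in> lists X" and q: "q \<in> lists X" "p \<noteq> q" "length p = length q"
    and eq: "\<And>s. s \<in> S \<Longrightarrow> act s p = act s q"
  shows "card (act_set act A (words_of_length X (n + length p)))
    \<le> (card X ^ length p - 1) * card (act_set act A (words_of_length X n))"
proof -
  interpret right_act "free_monoid X" S act by fact
  \<comment> \<open>Possible endings. Leaving out \<open>p\<close> loses no point, because
    \<open>q\<close> has the same length, acts in the same way and remains available.\<close>
  let ?D = "words_of_length X (length p) - {p}"
  let ?E = "act_set act A (words_of_length X n)"
  have "act_set act A (words_of_length X (n + length p)) \<subseteq> act_set act ?E ?D"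
  proof
    fix s assume "s \<in> act_set act A (words_of_length X (n + length p))"
    then obtain a w where aw: "a \<in> A" "w \<in> lists X" "length w = n + length p" "s = act a w"
      by (auto simp: act_set_def words_of_length_def)
    define w1 w2 where "w1 = take n w" and "w2 = drop n w"
    have w: "w = w1 @ w2" "w1 \<in> lists X" "w2 \<in> lists X" "length w1 = n" "length w2 = length p"
      using aw by (auto simp: w1_def w2_def dest: in_set_takeD in_set_dropD)
    have s: "s = act (act a w1) w2"
      using act_mult[of a w1 w2] aw w \<open>A \<subseteq> S\<close> by auto
    have E: "act a w1 \<in> ?E"
      using aw w by (auto simp: act_set_def words_of_length_def)
    have "act a w1 \<in> S"
      using act_closed[of a w1] aw w \<open>A \<subseteq> S\<close> by auto
    then have "s = act (act a w1) (if w2 = p then q else w2)"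
      using s eq by simp
    moreover have "(if w2 = p then q else w2) \<in> ?D"
      using q w by (auto simp: words_of_length_def)
    ultimately show "s \<in> act_set act ?E ?D"
      using E unfolding act_set_def[of act ?E] by blast
  qed
  moreover have fin: "finite ?E" "finite ?D"
    using assms(2,3) by (simp_all add: finite_act_set finite_words_of_length)
  ultimately have "card (act_set act A (words_of_length X (n + length p))) \<le> card ?E * card ?D"
    by (meson card_act_set_le card_mono finite_act_set order_trans)
  moreover have "card ?D = card X ^ length p - 1"
    using p assms(2) by (simp add: card_words_of_length card_Diff_singleton words_of_length_def
        flip: card_words_of_length)
  ultimately show ?thesis by (simp add: mult.commute)
qed

section \<open>Exponential upper bounds for the growth\<close>

text \<open>Each descent by \<open>k\<close> costs a factor \<open>\<mu> ^ k\<close> and leads to an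
  index below \<open>k\<close>, where \<open>K\<close> is a bound and \<open>\<mu> \<ge> 1\<close>
  makes the power harmless.\<close>

lemma exponential_bound_of_step:
  fixes c :: "nat \<Rightarrow> real"
  assumes "k > 0" "\<mu> \<ge> 1" "\<And>n. c (n + k) \<le> \<mu> ^ k * c n" "\<And>n. n < k \<Longrightarrow> c n \<le> K" "K \<ge> 0"
  shows "c n \<le> K * \<mu> ^ n"
proof (induction n rule: less_induct)
  case (less n)
  show ?case
  proof (cases "n < k")
    case True
    have "K * 1 \<le> K * \<mu> ^ n"
      using assms by (intro mult_left_mono one_le_power) auto
    then show ?thesis using assms(4)[OF True] by simp
  next
    case False
    then obtain m where m: "n = m + k" by (metis add.commute le_Suc_ex not_less)
    have "c n \<le> \<mu> ^ k * c m" using assms(3) m by simp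
    also have "\<dots> \<le> \<mu> ^ k * (K * \<mu> ^ m)"
      using less m assms by (intro mult_left_mono) auto
    finally show ?thesis by (simp add: m power_add mult_ac)
  qed
qed

text \<open>Words are sorted by length. A point may be reached by words of several lengths, so this
  is only an upper bound.\<close>

lemma growth_le_sum:
  "growth X act A n \<le> (\<Sum>i\<le>n. card (act_set act A (words_of_length X i)))"
proof -
  have "act_set act A (words_upto X n) = (\<Union>i\<le>n. act_set act A (words_of_length X i))"
    by (auto simp: act_set_def words_upto_def words_of_length_def)
  then show ?thesis
    unfolding growth_def by (simp add: card_UN_le)
qed

lemma unfaithful_growth_bound:
  assumes act: "right_act (free_monoid X) S act" and X: "finite X" "card X > 1"
    and A: "finite A" "A \<subseteq> S" and "\<not> faithful_act (free_monoid X) S act"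
  obtains K \<mu> :: real where "K > 0" "\<mu> > 1" "\<mu> < card X"
    "\<And>n. growth X act A n \<le> K * \<mu> ^ n"
proof -
  obtain u v where "u \<in> lists X" "v \<in> lists X" "u \<noteq> v" "\<And>s. s \<in> S \<Longrightarrow> act s u = act s v"
    using assms(6) unfolding faithful_act_def free_monoid_simps by blast
  then obtain p q where pq: "p \<in> lists X" "q \<in> lists X" "p \<noteq> q" "length p = length q"
      "length p \<ge> 2" "\<And>s. s \<in> S \<Longrightarrow> act s p = act s q"
    using equal_length_identity[OF act X(2), of u v] by metis
  define k where "k = length p"
  define r where "r = card X"
  have k: "k \<ge> 2" and r: "r \<ge> 2" using pq X by (auto simp: k_def r_def)
  have "(2::nat) ^ 2 \<le> 2 ^ k" using k by (intro power_increasing) auto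
  also have "\<dots> \<le> r ^ k" using r by (intro power_mono) auto
  finally have rk: "r ^ k \<ge> 4" by simp
  \<comment> \<open>Chosen so that \<open>\<mu> ^ k\<close> is the factor gained by \<open>k\<close>
    more letters. From \<open>r ^ k \<ge> 4\<close> it exceeds 1, as the division by
    \<open>\<mu> - 1\<close> in the geometric sum requires.\<close>
  define \<mu> where "\<mu> = root k (real (r ^ k - 1))"
  have mu_gt: "\<mu> > 1" using rk k by (simp add: \<mu>_def del: of_nat_diff)
  have mu_pow: "\<mu> ^ k = real (r ^ k - 1)" using k by (simp add: \<mu>_def)
  have "\<mu> ^ k < real r ^ k" unfolding mu_pow using rk by (simp flip: of_nat_power)
  then have mu_less: "\<mu> < real r" by (rule power_less_imp_less_base) simp
  define c where "c n = real (card (act_set act A (words_of_length X n)))" for n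
  define K where "K = real (card A * r ^ k)"
  have step: "c (n + k) \<le> \<mu> ^ k * c n" for n
    unfolding c_def mu_pow of_nat_mult[symmetric] of_nat_le_iff
    unfolding k_def r_def
    by (rule card_act_set_lengthen[OF act X(1) A pq(1-4)]) (rule pq(6))
  have init: "c n \<le> K" if "n < k" for n
  proof -
    have "card (act_set act A (words_of_length X n)) \<le> card A * r ^ n"
      using card_act_set_le[OF A(1) finite_words_of_length[OF X(1)], of act n]
      by (simp add: card_words_of_length X r_def)
    also have "\<dots> \<le> card A * r ^ k"
      using that r by (intro mult_left_mono power_increasing) auto
    finally show ?thesis unfolding c_def K_def of_nat_le_iff .
  qed
  have c: "c n \<le> K * \<mu> ^ n" for n
    using exponential_bound_of_step[of k \<mu> c K] k mu_gt step init by (simp add: K_def)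
  \<comment> \<open>The first summand comes from the geometric sum; adding 1 keeps \<open>L\<close>
    positive when \<open>A\<close> is empty and \<open>K\<close> is 0.\<close>
  define L where "L = K * \<mu> / (\<mu> - 1) + 1"
  have "real (growth X act A n) \<le> L * \<mu> ^ n" for n
  proof -
    have "real (growth X act A n) \<le> (\<Sum>i\<le>n. c i)"
      using growth_le_sum[of X act A n] unfolding c_def of_nat_sum[symmetric] of_nat_le_iff .
    also have "\<dots> \<le> (\<Sum>i\<le>n. K * \<mu> ^ i)" by (intro sum_mono c)
    also have "\<dots> = K * ((\<mu> ^ Suc n - 1) / (\<mu> - 1))"
      using mu_gt geometric_sum[of \<mu> "Suc n"] by (simp flip: sum_distrib_left lessThan_Suc_atMost)
    also have "\<dots> \<le> K * (\<mu> ^ Suc n / (\<mu> - 1))"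
      using mu_gt by (intro mult_left_mono divide_right_mono) (auto simp: K_def)
    also have "\<dots> \<le> L * \<mu> ^ n"
      using mu_gt by (simp add: L_def algebra_simps)
    finally show ?thesis .
  qed
  moreover have "L > 0" using mu_gt by (simp add: L_def K_def add_nonneg_pos)
  ultimately show thesis using that[of L \<mu>] mu_gt mu_less unfolding r_def by blast
qed

section \<open>Faithfulness from fast growth\<close>

lemma power_not_eventually_bounded:
  fixes x :: real
  assumes "x > 1"
  shows "\<not> eventually (\<lambda>n. x ^ n \<le> K) sequentially"
proof
  assume "eventually (\<lambda>n. x ^ n \<le> K) sequentially"
  moreover obtain m where m: "K < x ^ m" using real_arch_pow[OF assms] by blast
  ultimately obtain n where n: "n \<ge> m" "x ^ n \<le> K"
    by (metis eventually_sequentially nat_le_linear)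
  have "x ^ m \<le> x ^ n" using assms n by (intro power_increasing) auto
  then show False using m n by simp
qed

lemma faithful_of_subexponential:
  assumes act: "right_act (free_monoid X) S act" and X: "finite X" "card X > 1"
    and A: "finite A" "A \<subseteq> S"
    and sub: "subexponential (\<lambda>n. real (card X) ^ n / real (growth X act A n))"
  shows "faithful_act (free_monoid X) S act"
proof (rule ccontr)
  assume "\<not> ?thesis"
  then obtain K \<mu> :: real where K: "K > 0" "\<mu> > 1" "\<mu> < card X"
      "\<And>n. growth X act A n \<le> K * \<mu> ^ n"
    using unfaithful_growth_bound[OF act X A] by metis
  define f where "f n = real (card X) ^ n / real (growth X act A n)" for n
  have fpos: "f n > 0" for n using sub unfolding subexponential_def f_def by blast
  \<comment> \<open>Division by zero yields 0, so positivity of \<open>f\<close> excludes zero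
    growth.\<close>
  have gpos: "growth X act A n > 0" for n
    using fpos[of n] by (cases "growth X act A n") (auto simp: f_def)
  \<comment> \<open>\<open>1 < \<beta>\<close> gives \<open>f n \<le> \<beta> ^ n\<close>
    eventually, whence \<open>card X ^ n\<close> is at most
    \<open>K * (\<mu> * \<beta>) ^ n\<close>. As \<open>\<mu> * \<beta>\<close> is below
    \<open>card X\<close>, this fails for large \<open>n\<close>.\<close>
  have "1 < card X / \<mu>" using K by simp
  then obtain \<beta> where \<beta>: "1 < \<beta>" "\<beta> < card X / \<mu>" using dense by blast
  have "limsup (\<lambda>n. ereal (root n (f n))) < ereal \<beta>"
    using sub \<beta> unfolding subexponential_def f_def by (auto intro: le_less_trans)
  then have "eventually (\<lambda>n. ereal (root n (f n)) < ereal \<beta>) sequentially"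
    by (rule Limsup_lessD)
  then have "eventually (\<lambda>n. (card X / (\<mu> * \<beta>)) ^ n \<le> K) sequentially"
    \<comment> \<open>\<open>root 0\<close> is constantly 0, so \<open>root n (f n) ^ n\<close>
      equals \<open>f n\<close> only for positive \<open>n\<close>.\<close>
    using eventually_gt_at_top[of 0]
  proof eventually_elim
    case (elim n)
    then have "root n (f n) ^ n \<le> \<beta> ^ n"
      using fpos[of n] by (intro power_mono) auto
    then have "f n \<le> \<beta> ^ n" using elim fpos[of n] by simp
    then have "real (card X) ^ n \<le> \<beta> ^ n * growth X act A n"
      using gpos[of n] by (simp add: f_def field_simps)
    also have "\<dots> \<le> \<beta> ^ n * (K * \<mu> ^ n)"
      using \<beta> K by (intro mult_left_mono) auto
    finally show ?case
      using K \<beta> by (simp add: power_divide power_mult_distrib field_simps)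
  qed
  moreover have "card X / (\<mu> * \<beta>) > 1" using K \<beta> by (simp add: field_simps)
  ultimately show False using power_not_eventually_bounded by blast
qed

text \<open>The shift by \<open>C\<close> in the equivalence weakens the bound for unfaithful acts
  only by the constant factor \<open>\<mu> ^ C\<close>, so powers of \<open>card X / \<mu>\<close>
  would stay bounded.\<close>

lemma faithful_of_fg_maximal_growth:
  assumes act: "right_act (free_monoid X) S act" and X: "finite X" "card X > 1"
    and max: "fg_maximal_growth X S act"
  shows "faithful_act (free_monoid X) S act"
proof (rule ccontr)
  assume unf: "\<not> ?thesis"
  obtain A C where A: "finite A" "A \<subseteq> S"
    and C: "\<And>n. (\<Sum>i\<le>n. card X ^ i) \<le> growth X act A (n + C)"
    using max unfolding fg_maximal_growth_def growth_equiv_def generates_act_def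
      growth_free_act[OF X(1)] by blast
  obtain K \<mu> :: real where K: "K > 0" "\<mu> > 1" "\<mu> < card X"
      "\<And>n. growth X act A n \<le> K * \<mu> ^ n"
    using unfaithful_growth_bound[OF act X A unf] by metis
  have "(card X / \<mu>) ^ n \<le> K * \<mu> ^ C" for n
  proof -
    have "card X ^ n \<le> (\<Sum>i\<le>n. card X ^ i)" by (intro member_le_sum) auto
    also have "\<dots> \<le> growth X act A (n + C)" by (rule C)
    finally have "real (card X ^ n) \<le> growth X act A (n + C)" by simp
    also have "\<dots> \<le> K * \<mu> ^ (n + C)" by (rule K)
    finally show ?thesis
      using K by (simp add: power_divide power_add field_simps)
  qed
  moreover have "card X / \<mu> > 1" using K by simp
  ultimately show False
    using power_not_eventually_bounded[of "card X / \<mu>" "K * \<mu> ^ C"] by simp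
qed

lemma right_act_subact:
  assumes "right_act M S act" "subact M T S act"
  shows "right_act M T act"
proof -
  interpret right_act M S act by fact
  show ?thesis
    using assms(2) act_one act_mult by unfold_locales (auto simp: subact_def)
qed

text \<open>A point of the subact that separates two words is also a point of
  \<open>S\<close>.\<close>

lemma faithful_of_maximal_growth:
  assumes act: "right_act (free_monoid X) S act" and X: "finite X" "card X > 1"
    and max: "maximal_growth X S act"
  shows "faithful_act (free_monoid X) S act"
proof -
  obtain T where T: "subact (free_monoid X) T S act" "fg_maximal_growth X T act"
    using max unfolding maximal_growth_def by blast
  then have "faithful_act (free_monoid X) T act"
    using faithful_of_fg_maximal_growth[OF right_act_subact[OF act]] X by blast
  then show ?thesis
    using T(1) unfolding faithful_act_def subact_def by blast
qed

theorem proposition6: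
  fixes X :: "'x set" and r :: nat and S :: "'s set" and act :: "'s \<Rightarrow> 'x list \<Rightarrow> 's"
  assumes "finite X" and "card X = r" and "r > 1"
    and "right_act (free_monoid X) S act"
  shows "(\<forall>A. finite A \<and> generates_act (free_monoid X) S act A \<and>
            subexponential (\<lambda>n. real r ^ n / real (growth X act A n))
            \<longrightarrow> faithful_act (free_monoid X) S act)
       \<and> (maximal_growth X S act \<longrightarrow> faithful_act (free_monoid X) S act)"
  using assms faithful_of_subexponential[of X S act] faithful_of_maximal_growth[of X S act]
  unfolding generates_act_def by blast

end
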